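(* Let $\mathcal G$ be a fan with $n$ leaves, each of which has been assigned a positive value $v_j$ ($1\le j\le n$). The optimal strategy for the Chooser in the Path Guessing Game on $\mathcal G$ is to make his choice $C$ independently of the Guesser's actions, with $$p(j)=\mathrm{Prob}(C=j)=\begin{cases}1 & \text{if } n=1,\\[2pt] \dfrac{v_j^{-1}}{\sum_{k=1}^n v_k^{-1}} & \text{if } n\ge 2.\end{cases}$$ The optimal strategy for the Guesser is characterized by $$W=\begin{cases}1 & \text{if } n=1,\\ 1-n\beta p_{\min} & \text{if } n\ge2,\end{cases}$$ and $$q(j\mid w)=\mathrm{Prob}(G=j\mid W=w)=\begin{cases}1 & \text{if } n=1,\\[2pt] \dfrac{n\,p(j)-1+w}{n\,w} & \text{if } n\ge2,\end{cases}$$ where $p_{\min}=\min\{p(j):1\le j\le n\}$ and $\beta$ is any random variable with support in $[0,1]$. Under optimal play, the Guesser's expected fortune at the end of the game is given by $$E[F]=\begin{cases}2v_1 & \text{if } n=1,\\[2pt] \dfrac{n}{\sum_{j=1}^n v_j^{-1}} & \text{if } n\ge 2.\end{cases}$$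
   Context: A fan with $n$ leaves is a tree of height $1$ on $n+1$ nodes (a root and the leaves $1,\dots,n$). The Path Guessing Game on it: both players start at the root, know the values $v_j$, and the Guesser has initial fortune $1$. The Guesser chooses a wager $W\in[0,1]$ and a guess $G\in\{1,\dots,n\}$, possibly at random. The wager is announced to the Chooser; the guess is kept secret. The Chooser then selects a leaf $C\in\{1,\dots,n\}$, possibly at random. If $n\ge2$, the Guesser's fortune becomes $1+(n-1)W$ if $G=C$ and $1-W$ if $G\ne C$; if $n=1$ the guess is necessarily correct and her fortune becomes $1+W$. This fortune is then multiplied by the value $v_C$ of the selected leaf; the result is the final fortune $F$. The choice $C$ and the guess $G$ are assumed independent, but $C$ may depend on the announced wager $W$; thus the Chooser's strategy is determined by the conditional probabilities $p(j\mid w)=\mathrm{Prob}(C=j\mid W=w)$. The Guesser's strategy is the joint distribution of $G$ and $W$, determined by the conditional probabilities $q(j\mid w)=\mathrm{Prob}(G=j\mid W=w)$ together with the distribution of $W$. The Chooser's goal is to minimize $E[F]$, while the Guesser's goal is to maximize $E[F]$. The Chooser's optimal strategy is asserted to be unique, while the Guesser has a family of optimal strategies, indexed by $\beta$.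
   Formalization: Chooser's optimal strategy is unique only among wager-independent choices, and otherwise p(j|w)=p(j) is forced only for w>1-n p_min (every w if n=1), since smaller wagers allow other optimal choices; the formula for q(j|w) is not required at w=0, where it reads 0/0. *)

theory Defs
  imports "HOL-Probability.Probability"
begin

abbreviation unit_borel :: "real measure" where
  "unit_borel \<equiv> restrict_space borel {0..1}"

definition unit_laws :: "real measure set" where
  "unit_laws = {M. prob_space M \<and> sets M = sets unit_borel}"

text \<open>
  The leaves of the fan are \<open>1, \<dots>, n\<close>. A conditional distribution on the leaves given a
  number in the unit interval (the wager) is a measurable family of probability mass
  functions. Its values at reals outside the unit interval never play a role.
\<close>

definition leaf_kernels :: "nat \<Rightarrow> (real \<Rightarrow> nat pmf) set" where
  "leaf_kernels n = {k. (\<forall>w\<in>{0..1}. set_pmf (k w) \<subseteq> {1..n}) \<and>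
                        (\<forall>j. (\<lambda>w. pmf (k w) j) \<in> borel_measurable unit_borel)}"

definition chooser_strategies :: "nat \<Rightarrow> (real \<Rightarrow> nat pmf) set" where
  "chooser_strategies n = leaf_kernels n"

text \<open>
  A strategy of the Guesser is the joint law of wager and guess, given by the law of the wager
  and the conditional law of the guess given the wager.
\<close>

definition guesser_strategies :: "nat \<Rightarrow> (real measure \<times> (real \<Rightarrow> nat pmf)) set" where
  "guesser_strategies n = unit_laws \<times> leaf_kernels n"

definition final_fortune :: "nat \<Rightarrow> (nat \<Rightarrow> real) \<Rightarrow> real \<Rightarrow> nat \<Rightarrow> nat \<Rightarrow> real" where
  "final_fortune n v w g c =
     (if n = 1 then 1 + w else if g = c then 1 + (real n - 1) * w else 1 - w) * v c"

text \<open>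
  Guess and choice are independent given the announced wager, so their joint conditional law
  is a product, and the expectation is taken by first conditioning on the wager. The integrand
  is bounded and measurable for all strategies as above, so the integral exists.
\<close>

definition expected_fortune ::
    "nat \<Rightarrow> (nat \<Rightarrow> real) \<Rightarrow> real measure \<times> (real \<Rightarrow> nat pmf) \<Rightarrow> (real \<Rightarrow> nat pmf) \<Rightarrow> real" where
  "expected_fortune n v s p =
     (\<integral>w. measure_pmf.expectation (pair_pmf (snd s w) (p w))
             (\<lambda>(g, c). final_fortune n v w g c) \<partial>(fst s))"

text \<open>
  Optimality is in the minimax sense for the zero-sum game with payoff \<open>expected_fortune\<close>:
  the Chooser minimizes the largest, and the Guesser maximizes the smallest, expected final
  fortune that the opponent can enforce.
\<close>

definition chooser_optimal :: "nat \<Rightarrow> (nat \<Rightarrow> real) \<Rightarrow> (real \<Rightarrow> nat pmf) \<Rightarrow> bool" where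
  "chooser_optimal n v p \<longleftrightarrow> p \<in> chooser_strategies n \<and>
     (\<forall>p'\<in>chooser_strategies n.
        (SUP s\<in>guesser_strategies n. ereal (expected_fortune n v s p)) \<le>
        (SUP s\<in>guesser_strategies n. ereal (expected_fortune n v s p')))"

definition guesser_optimal ::
    "nat \<Rightarrow> (nat \<Rightarrow> real) \<Rightarrow> real measure \<times> (real \<Rightarrow> nat pmf) \<Rightarrow> bool" where
  "guesser_optimal n v s \<longleftrightarrow> s \<in> guesser_strategies n \<and>
     (\<forall>s'\<in>guesser_strategies n.
        (INF p\<in>chooser_strategies n. ereal (expected_fortune n v s' p)) \<le>
        (INF p\<in>chooser_strategies n. ereal (expected_fortune n v s p)))"

definition choice_prob :: "nat \<Rightarrow> (nat \<Rightarrow> real) \<Rightarrow> nat \<Rightarrow> real" where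
  "choice_prob n v j = (if n = 1 then 1 else inverse (v j) / (\<Sum>k=1..n. inverse (v k)))"

definition p_min :: "nat \<Rightarrow> (nat \<Rightarrow> real) \<Rightarrow> real" where
  "p_min n v = Min (choice_prob n v ` {1..n})"

definition wager :: "nat \<Rightarrow> (nat \<Rightarrow> real) \<Rightarrow> real \<Rightarrow> real" where
  "wager n v b = (if n = 1 then 1 else 1 - real n * b * p_min n v)"

definition guess_prob :: "nat \<Rightarrow> (nat \<Rightarrow> real) \<Rightarrow> real \<Rightarrow> nat \<Rightarrow> real" where
  "guess_prob n v w j =
     (if n = 1 then 1 else (real n * choice_prob n v j - 1 + w) / (real n * w))"

text \<open>
  Here \<open>B\<close> is the law of the random variable that indexes the Guesser's family of strategies.
  Conditional probabilities given the wager are determined only almost surely. The wager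
  \<open>0\<close> is excluded because the formula for \<open>guess_prob\<close> divides by it; that wager can occur
  only when all values are equal, and the fortune then does not depend on the guess.
\<close>

definition guesser_family ::
    "nat \<Rightarrow> (nat \<Rightarrow> real) \<Rightarrow> real measure \<Rightarrow> (real measure \<times> (real \<Rightarrow> nat pmf)) set" where
  "guesser_family n v B = {s \<in> guesser_strategies n.
     fst s = distr B unit_borel (wager n v) \<and>
     (AE w in fst s. w \<noteq> 0 \<longrightarrow> (\<forall>j\<in>{1..n}. pmf (snd s w) j = guess_prob n v w j))}"

end

theory Submission
  imports Defs
begin

text \<open>
  For \<open>n \<ge> 2\<close>, a guess distribution \<open>q\<close> and a choice distribution \<open>p\<close> at wager \<open>w\<close> yield the
  expectation \<open>\<Sum>c. p c * v c * (1 - w + n * w * q c)\<close>. Choosing \<open>c\<close> with probability proportional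
  to \<open>1 / v c\<close> makes it equal to the value \<open>n / (\<Sum>k. 1 / v k)\<close> for all \<open>w\<close> and \<open>q\<close>, and wagering
  everything with \<open>q\<close> equal to this distribution makes it equal to the value for all \<open>p\<close>. So a
  strategy is optimal iff it secures the value. A Guesser secures it iff almost surely
  \<open>v c * (1 - w + n * w * q c)\<close> does not depend on \<open>c\<close>: otherwise the Chooser gains by
  deviating to a leaf \<open>c\<close> at exactly those wagers at which it is below the value.
\<close>

section \<open>Distributions on finite sets, leaf kernels and laws on the unit interval\<close>

lemma ex_pmf_on_finite:
  fixes f :: "'a \<Rightarrow> real"
  assumes "finite A" "\<And>a. a \<in> A \<Longrightarrow> 0 \<le> f a" "sum f A = 1"
  shows "\<exists>q. set_pmf q \<subseteq> A \<and> (\<forall>a\<in>A. pmf q a = f a)"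
proof -
  define g where "g a = (if a \<in> A then f a else 0)" for a
  have nonneg: "0 \<le> g a" for a
    using assms(2) by (simp add: g_def)
  have "(\<integral>\<^sup>+a. ennreal (g a) \<partial>count_space UNIV) = (\<Sum>a\<in>A. ennreal (g a))"
    by (rule nn_integral_count_space'[OF assms(1)]) (auto simp: g_def)
  also have "\<dots> = ennreal (sum g A)"
    by (simp add: nonneg sum_ennreal)
  also have "sum g A = 1"
    using assms(3) by (simp add: g_def)
  finally have pmf: "pmf (embed_pmf g) a = g a" for a
    using nonneg by (simp add: pmf_embed_pmf)
  show ?thesis
    by (rule exI[of _ "embed_pmf g"]) (auto simp: set_pmf_eq pmf g_def split: if_splits)
qed

lemma pmf_eqI_on:
  assumes "set_pmf q \<subseteq> A" "set_pmf r \<subseteq> A" "\<And>a. a \<in> A \<Longrightarrow> pmf q a = pmf r a"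
  shows "q = r"
proof (rule pmf_eqI)
  fix a
  show "pmf q a = pmf r a"
  proof (cases "a \<in> A")
    case False
    then have "a \<notin> set_pmf q" "a \<notin> set_pmf r"
      using assms(1,2) by auto
    then show ?thesis
      by (simp add: set_pmf_iff)
  qed (rule assms(3))
qed

lemma const_leaf_kernel: "set_pmf r \<subseteq> {1..n} \<Longrightarrow> (\<lambda>w. r) \<in> leaf_kernels n"
  by (simp add: leaf_kernels_def)

lemma leaf_kernel_subset: "k \<in> leaf_kernels n \<Longrightarrow> w \<in> {0..1} \<Longrightarrow> set_pmf (k w) \<subseteq> {1..n}"
  by (auto simp: leaf_kernels_def)

lemma leaf_kernel_measurable:
  "k \<in> leaf_kernels n \<Longrightarrow> (\<lambda>w. pmf (k w) j) \<in> borel_measurable unit_borel"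
  by (simp add: leaf_kernels_def)

text \<open>Lets the Chooser deviate on a measurable set of wagers only, as the analysis of the
  Guesser's optimal strategies requires.\<close>

lemma leaf_kernel_If:
  assumes "k \<in> leaf_kernels n" "l \<in> leaf_kernels n" "Measurable.pred unit_borel P"
  shows "(\<lambda>w. if P w then k w else l w) \<in> leaf_kernels n"
proof -
  have "(\<lambda>w. pmf (if P w then k w else l w) j) \<in> borel_measurable unit_borel" for j
  proof -
    have "(\<lambda>w. if P w then pmf (k w) j else pmf (l w) j) \<in> borel_measurable unit_borel"
      using assms by (intro measurable_If leaf_kernel_measurable) (auto simp: pred_def)
    then show ?thesis
      by (simp add: if_distrib[of "\<lambda>q. pmf q j"] cong: if_cong)
  qed
  then show ?thesis
    using assms by (auto simp: leaf_kernels_def)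
qed

lemma unit_lawD:
  assumes "M \<in> unit_laws"
  shows unit_law_prob_space: "prob_space M"
    and unit_law_sets: "sets M = sets unit_borel"
    and unit_law_space: "space M = {0..1}"
proof -
  show *: "prob_space M" "sets M = sets unit_borel"
    using assms by (auto simp: unit_laws_def)
  show "space M = {0..1}"
    using sets_eq_imp_space_eq[OF *(2)] by (simp add: space_restrict_space)
qed

lemma distr_unit_law:
  assumes "M \<in> unit_laws" "f \<in> measurable unit_borel unit_borel"
  shows "distr M unit_borel f \<in> unit_laws"
proof -
  have "f \<in> measurable M unit_borel"
    using assms(2) measurable_cong_sets[OF unit_law_sets[OF assms(1)] refl] by blast
  then show ?thesis
    using prob_space.prob_space_distr[OF unit_law_prob_space[OF assms(1)]]
    by (simp add: unit_laws_def)
qed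

lemma return_unit_law: "w \<in> {0..1} \<Longrightarrow> return unit_borel w \<in> unit_laws"
  by (simp add: unit_laws_def prob_space_return space_restrict_space)

lemma unit_borel_measurable_ident [measurable]: "(\<lambda>w. w) \<in> borel_measurable unit_borel"
  by (rule measurable_restrict_space1) simp

section \<open>The fan, its value and the expected fortune at a fixed wager\<close>

locale fan =
  fixes n :: nat and v :: "nat \<Rightarrow> real"
  assumes n_ge_1: "n \<ge> 1"
    and v_pos: "\<And>j. j \<in> {1..n} \<Longrightarrow> v j > 0"
begin

declare One_nat_def [simp del]

definition cond_fortune :: "real \<Rightarrow> nat pmf \<Rightarrow> nat pmf \<Rightarrow> real" where
  "cond_fortune w q p =
     measure_pmf.expectation (pair_pmf q p) (\<lambda>(g, c). final_fortune n v w g c)"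

definition game_value :: real where
  "game_value = (if n = 1 then 2 * v 1 else real n / (\<Sum>j=1..n. inverse (v j)))"

abbreviation cprob :: "nat \<Rightarrow> real" where
  "cprob \<equiv> choice_prob n v"

lemma expected_fortune_eq:
  "expected_fortune n v s p = (\<integral>w. cond_fortune w (snd s w) (p w) \<partial>fst s)"
  by (simp add: expected_fortune_def cond_fortune_def)

lemma sum_inverse_pos: "(\<Sum>j=1..n. inverse (v j)) > 0"
  using n_ge_1 v_pos by (intro sum_pos) auto

lemma cprob_pos: "j \<in> {1..n} \<Longrightarrow> cprob j > 0"
  using sum_inverse_pos v_pos by (simp add: choice_prob_def)

lemma sum_cprob: "(\<Sum>j=1..n. cprob j) = 1"
  using sum_inverse_pos by (cases "n = 1") (simp_all add: choice_prob_def flip: sum_divide_distrib)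

text \<open>Each equalization below rests on this identity. It fails for \<open>n = 1\<close>, where
  the sure gain of the stake gives \<open>game_value\<close> an extra factor 2.\<close>

lemma n_v_cprob: "n \<noteq> 1 \<Longrightarrow> j \<in> {1..n} \<Longrightarrow> real n * v j * cprob j = game_value"
  using v_pos[of j] by (simp add: choice_prob_def game_value_def)

lemma p_min_le: "j \<in> {1..n} \<Longrightarrow> p_min n v \<le> cprob j"
  by (simp add: p_min_def)

lemma p_min_pos: "p_min n v > 0"
  using n_ge_1 cprob_pos by (auto simp: p_min_def)

text \<open>A minimum is at most the average. The bound keeps the wagers
  \<open>1 - n * b * p_min\<close> nonnegative.\<close>

lemma n_p_min_le_1: "real n * p_min n v \<le> 1"
proof -
  have "(\<Sum>j=1..n. p_min n v) \<le> (\<Sum>j=1..n. cprob j)"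
    by (intro sum_mono p_min_le)
  then show ?thesis
    by (simp add: sum_cprob)
qed

lemma ex_choice_pmf:
  obtains r where "set_pmf r \<subseteq> {1..n}" "\<And>j. j \<in> {1..n} \<Longrightarrow> pmf r j = cprob j"
  using ex_pmf_on_finite[of "{1..n}" cprob] cprob_pos sum_cprob
  by (metis finite_atLeastAtMost less_imp_le)

lemma cond_fortune_single:
  assumes "n = 1" "set_pmf q \<subseteq> {1..n}" "set_pmf p \<subseteq> {1..n}"
  shows "cond_fortune w q p = (1 + w) * v 1"
proof -
  have "q = return_pmf 1" "p = return_pmf 1"
    using assms by (simp_all add: set_pmf_subset_singleton)
  then show ?thesis
    unfolding cond_fortune_def by (simp add: assms(1) final_fortune_def pair_return_pmf1)
qed

text \<open>Every guess keeps \<open>1 - w\<close> and a correct one adds \<open>n * w\<close>, so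
  only the probability of guessing the chosen leaf matters.\<close>

lemma cond_fortune_multi:
  assumes "n \<noteq> 1" and q: "set_pmf q \<subseteq> {1..n}" and p: "set_pmf p \<subseteq> {1..n}"
  shows "cond_fortune w q p = (\<Sum>c=1..n. pmf p c * (v c * (1 - w + real n * w * pmf q c)))"
proof -
  have "cond_fortune w q p =
      (\<Sum>x\<in>{1..n} \<times> {1..n}. (\<lambda>(g, c). final_fortune n v w g c) x * pmf (pair_pmf q p) x)"
    unfolding cond_fortune_def using p q
    by (intro integral_measure_pmf_real) auto
  also have "\<dots> = (\<Sum>(g, c)\<in>{1..n} \<times> {1..n}. final_fortune n v w g c * (pmf q g * pmf p c))"
    by (intro sum.cong) (auto simp: pmf_pair)
  also have "\<dots> = (\<Sum>c=1..n. \<Sum>g=1..n. final_fortune n v w g c * (pmf q g * pmf p c))"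
    unfolding sum.cartesian_product[symmetric] by (rule sum.swap)
  also have "\<dots> = (\<Sum>c=1..n. pmf p c * (v c * (1 - w + real n * w * pmf q c)))"
  proof (rule sum.cong[OF refl])
    fix c assume c: "c \<in> {1..n}"
    have "(\<Sum>g=1..n. final_fortune n v w g c * (pmf q g * pmf p c)) =
        (\<Sum>g=1..n. pmf p c * v c * ((1 - w) * pmf q g + (if g = c then real n * w * pmf q c else 0)))"
      using assms(1) by (intro sum.cong) (auto simp: final_fortune_def algebra_simps)
    also have "\<dots> = pmf p c * v c * ((1 - w) * (\<Sum>g=1..n. pmf q g) + real n * w * pmf q c)"
      using c by (simp add: sum.distrib flip: sum_distrib_left)
    also have "(\<Sum>g=1..n. pmf q g) = 1"
      using q by (intro sum_pmf_eq_1) auto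
    finally show "(\<Sum>g=1..n. final_fortune n v w g c * (pmf q g * pmf p c)) =
        pmf p c * (v c * (1 - w + real n * w * pmf q c))"
      by simp
  qed
  finally show ?thesis .
qed

lemma cond_fortune_measurable:
  assumes "q \<in> leaf_kernels n" "p \<in> leaf_kernels n"
  shows "(\<lambda>w. cond_fortune w (q w) (p w)) \<in> borel_measurable unit_borel"
proof -
  note [measurable] = leaf_kernel_measurable[OF assms(1)] leaf_kernel_measurable[OF assms(2)]
  note sub = leaf_kernel_subset[OF assms(1)] leaf_kernel_subset[OF assms(2)]
  show ?thesis
  proof (cases "n = 1")
    case True
    have "(\<lambda>w. (1 + w) * v 1) \<in> borel_measurable unit_borel"
      by measurable
    moreover have "cond_fortune w (q w) (p w) = (1 + w) * v 1" if "w \<in> space unit_borel" for w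
      using that sub by (intro cond_fortune_single[OF True]) (simp_all add: space_restrict_space)
    ultimately show ?thesis
      by (subst measurable_cong)
  next
    case False
    have "(\<lambda>w. \<Sum>c=1..n. pmf (p w) c * (v c * (1 - w + real n * w * pmf (q w) c)))
        \<in> borel_measurable unit_borel"
      by measurable
    moreover have "cond_fortune w (q w) (p w) =
        (\<Sum>c=1..n. pmf (p w) c * (v c * (1 - w + real n * w * pmf (q w) c)))"
      if "w \<in> space unit_borel" for w
      using that sub by (intro cond_fortune_multi[OF False]) (simp_all add: space_restrict_space)
    ultimately show ?thesis
      by (subst measurable_cong)
  qed
qed

lemma expected_fortune_AE_const:
  assumes "s \<in> guesser_strategies n" "p \<in> chooser_strategies n"
    and "AE w in fst s. cond_fortune w (snd s w) (p w) = x"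
  shows "expected_fortune n v s p = x"
proof -
  have M: "fst s \<in> unit_laws" and q: "snd s \<in> leaf_kernels n"
    using assms(1) by (auto simp: guesser_strategies_def)
  interpret prob_space "fst s"
    by (rule unit_law_prob_space[OF M])
  have "(\<lambda>w. cond_fortune w (snd s w) (p w)) \<in> borel_measurable (fst s)"
    using cond_fortune_measurable[OF q, of p] assms(2)
    by (simp add: chooser_strategies_def measurable_cong_sets[OF unit_law_sets[OF M] refl])
  then have "expected_fortune n v s p = (\<integral>w. x \<partial>fst s)"
    unfolding expected_fortune_eq using assms(3) by (intro integral_cong_AE) auto
  then show ?thesis
    by (simp add: prob_space)
qed

text \<open>Point masses on a single wager expose a Chooser's strategy at that very wager, so that
  its optimality has consequences at every \<open>w\<close> and not just almost everywhere.\<close>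

lemma expected_fortune_return:
  assumes "w \<in> {0..1}" "set_pmf q \<subseteq> {1..n}" "p \<in> chooser_strategies n"
  shows "(return unit_borel w, \<lambda>_. q) \<in> guesser_strategies n"
    and "expected_fortune n v (return unit_borel w, \<lambda>_. q) p = cond_fortune w q (p w)"
proof -
  show s: "(return unit_borel w, \<lambda>_. q) \<in> guesser_strategies n"
    using assms by (simp add: guesser_strategies_def return_unit_law const_leaf_kernel)
  have "(\<lambda>w. cond_fortune w q (p w)) \<in> borel_measurable unit_borel"
    using assms(3)
    by (intro cond_fortune_measurable const_leaf_kernel assms) (simp add: chooser_strategies_def)
  then show "expected_fortune n v (return unit_borel w, \<lambda>_. q) p = cond_fortune w q (p w)"
    using assms(1) unfolding expected_fortune_eq
    by (simp add: integral_return space_restrict_space)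
qed

section \<open>Strategies that secure the value\<close>

text \<open>The factor \<open>v c * cprob c\<close> is the same for all leaves, and the multipliers
  \<open>1 - w + n * w * q c\<close> sum to \<open>n\<close> for all \<open>w\<close> and
  \<open>q\<close>.\<close>

lemma cond_fortune_cprob_choice:
  assumes "set_pmf q \<subseteq> {1..n}" "set_pmf r \<subseteq> {1..n}" "\<And>j. j \<in> {1..n} \<Longrightarrow> pmf r j = cprob j"
    and "n \<noteq> 1"
  shows "cond_fortune w q r = game_value"
proof -
  have "real n * cond_fortune w q r =
      (\<Sum>c=1..n. (real n * v c * cprob c) * (1 - w + real n * w * pmf q c))"
    using assms by (simp add: cond_fortune_multi sum_distrib_left ac_simps)
  also have "\<dots> = (\<Sum>c=1..n. game_value * (1 - w + real n * w * pmf q c))"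
    using assms(4) by (intro sum.cong) (auto simp: n_v_cprob)
  also have "\<dots> = game_value * (real n * (1 - w) + real n * w * (\<Sum>c=1..n. pmf q c))"
    by (simp add: sum.distrib flip: sum_distrib_left)
  also have "(\<Sum>c=1..n. pmf q c) = 1"
    using assms by (intro sum_pmf_eq_1) auto
  finally have "real n * cond_fortune w q r = real n * game_value"
    by (simp add: algebra_simps)
  then show ?thesis
    using n_ge_1 by simp
qed

text \<open>Only an inequality because of \<open>n = 1\<close>, where a wager below 1 forgoes a sure
  gain; for \<open>n \<ge> 2\<close> equality holds.\<close>

lemma expected_fortune_cprob_choice:
  assumes s: "s \<in> guesser_strategies n"
    and r: "set_pmf r \<subseteq> {1..n}" "\<And>j. j \<in> {1..n} \<Longrightarrow> pmf r j = cprob j"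
  shows "expected_fortune n v s (\<lambda>_. r) \<le> game_value"
proof -
  have M: "fst s \<in> unit_laws" and q: "snd s \<in> leaf_kernels n"
    using s by (auto simp: guesser_strategies_def)
  interpret prob_space "fst s"
    by (rule unit_law_prob_space[OF M])
  note sub = leaf_kernel_subset[OF q]
  show ?thesis
  proof (cases "n = 1")
    case True
    have eq: "cond_fortune w (snd s w) r = (1 + w) * v 1" if "w \<in> {0..1}" for w
      using sub[OF that] r(1) by (rule cond_fortune_single[OF True])
    have bounds: "0 \<le> (1 + w) * v 1" "(1 + w) * v 1 \<le> 2 * v 1" if "w \<in> {0..1}" for w
      using that v_pos[of 1] True by (simp_all add: mult_right_mono)
    have "(\<lambda>w. (1 + w) * v 1) \<in> borel_measurable (fst s)"
      unfolding measurable_cong_sets[OF unit_law_sets[OF M] refl] by measurable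
    then have "integrable (fst s) (\<lambda>w. (1 + w) * v 1)"
      using bounds by (intro integrable_const_bound[where B = "2 * v 1"] AE_I2)
        (simp_all add: unit_law_space[OF M])
    then have "(\<integral>w. (1 + w) * v 1 \<partial>fst s) \<le> 2 * v 1"
      using bounds by (intro integral_le_const AE_I2) (simp_all add: unit_law_space[OF M])
    also have "(\<integral>w. (1 + w) * v 1 \<partial>fst s) = expected_fortune n v s (\<lambda>_. r)"
      unfolding expected_fortune_eq
      by (rule Bochner_Integration.integral_cong[OF refl]) (simp add: eq unit_law_space[OF M])
    finally show ?thesis
      using True unfolding game_value_def by simp
  next
    case False
    have "expected_fortune n v s (\<lambda>_. r) = game_value"
      using s r False sub cond_fortune_cprob_choice
      by (intro expected_fortune_AE_const)
         (auto simp: chooser_strategies_def const_leaf_kernel unit_law_space[OF M])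
    then show ?thesis
      by simp
  qed
qed

text \<open>For \<open>n \<ge> 2\<close>, a wrong guess at wager 1 leaves nothing, so leaf
  \<open>c\<close> pays \<open>n * v c * cprob c\<close>, the same for every leaf.\<close>

lemma full_wager_secures_value:
  assumes "set_pmf r \<subseteq> {1..n}" "\<And>j. j \<in> {1..n} \<Longrightarrow> pmf r j = cprob j"
    and p: "p \<in> chooser_strategies n"
  shows "expected_fortune n v (return unit_borel 1, \<lambda>_. r) p = game_value"
proof -
  have sub: "set_pmf (p 1) \<subseteq> {1..n}"
    using p leaf_kernel_subset by (auto simp: chooser_strategies_def)
  have "expected_fortune n v (return unit_borel 1, \<lambda>_. r) p = cond_fortune 1 r (p 1)"
    using assms by (intro expected_fortune_return) auto
  also have "\<dots> = game_value"
  proof (cases "n = 1")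
    case True
    then show ?thesis
      using assms sub unfolding game_value_def by (subst cond_fortune_single) simp_all
  next
    case False
    have "cond_fortune 1 r (p 1) = (\<Sum>c=1..n. pmf (p 1) c * game_value)"
      using assms sub False
      by (subst cond_fortune_multi) (auto simp: n_v_cprob[symmetric] intro!: sum.cong)
    also have "\<dots> = game_value"
      using sub by (simp add: sum_pmf_eq_1 flip: sum_distrib_right)
    finally show ?thesis .
  qed
  finally show ?thesis .
qed

section \<open>Optimality as securing the value\<close>

text \<open>Against the full wager no Chooser concedes less than the value, and the constant choice
  \<open>r\<close> never concedes more. So the least supremum is \<open>game_value\<close>, and it
  is attained.\<close>

lemma chooser_optimal_iff:
  "chooser_optimal n v p \<longleftrightarrow> p \<in> chooser_strategies n \<and>
     (\<forall>s\<in>guesser_strategies n. expected_fortune n v s p \<le> game_value)"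
proof -
  obtain r where r: "set_pmf r \<subseteq> {1..n}" "\<And>j. j \<in> {1..n} \<Longrightarrow> pmf r j = cprob j"
    using ex_choice_pmf by blast
  have r_strat: "(\<lambda>_. r) \<in> chooser_strategies n"
    using r by (simp add: chooser_strategies_def const_leaf_kernel)
  have s_strat: "(return unit_borel 1, \<lambda>_. r) \<in> guesser_strategies n"
    using expected_fortune_return(1)[OF _ r(1) r_strat, of 1] by simp
  have upper: "(SUP s\<in>guesser_strategies n. ereal (expected_fortune n v s (\<lambda>_. r))) \<le> ereal game_value"
    using expected_fortune_cprob_choice[OF _ r] by (auto intro!: SUP_least)
  have lower: "ereal game_value \<le> (SUP s\<in>guesser_strategies n. ereal (expected_fortune n v s p'))"
    if "p' \<in> chooser_strategies n" for p'
    using full_wager_secures_value[OF r that] by (intro SUP_upper2[OF s_strat]) simp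
  have "(\<forall>p'\<in>chooser_strategies n.
        (SUP s\<in>guesser_strategies n. ereal (expected_fortune n v s p)) \<le>
        (SUP s\<in>guesser_strategies n. ereal (expected_fortune n v s p'))) \<longleftrightarrow>
      (SUP s\<in>guesser_strategies n. ereal (expected_fortune n v s p)) \<le> ereal game_value"
    using r_strat upper lower order_trans by blast
  then show ?thesis
    by (simp add: chooser_optimal_def SUP_le_iff)
qed

text \<open>The dual argument: the full wager secures the value, and the constant choice
  \<open>r\<close> caps every Guesser at it.\<close>

lemma guesser_optimal_iff:
  "guesser_optimal n v s \<longleftrightarrow> s \<in> guesser_strategies n \<and>
     (\<forall>p\<in>chooser_strategies n. game_value \<le> expected_fortune n v s p)"
proof -
  obtain r where r: "set_pmf r \<subseteq> {1..n}" "\<And>j. j \<in> {1..n} \<Longrightarrow> pmf r j = cprob j"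
    using ex_choice_pmf by blast
  have r_strat: "(\<lambda>_. r) \<in> chooser_strategies n"
    using r by (simp add: chooser_strategies_def const_leaf_kernel)
  have s_strat: "(return unit_borel 1, \<lambda>_. r) \<in> guesser_strategies n"
    using expected_fortune_return(1)[OF _ r(1) r_strat, of 1] by simp
  have lower: "ereal game_value \<le> (INF p\<in>chooser_strategies n.
      ereal (expected_fortune n v (return unit_borel 1, \<lambda>_. r) p))"
    using full_wager_secures_value[OF r] by (auto intro!: INF_greatest)
  have upper: "(INF p\<in>chooser_strategies n. ereal (expected_fortune n v s' p)) \<le> ereal game_value"
    if "s' \<in> guesser_strategies n" for s'
    using expected_fortune_cprob_choice[OF that r] by (intro INF_lower2[OF r_strat]) simp
  have "(\<forall>s'\<in>guesser_strategies n.
        (INF p\<in>chooser_strategies n. ereal (expected_fortune n v s' p)) \<le>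
        (INF p\<in>chooser_strategies n. ereal (expected_fortune n v s p))) \<longleftrightarrow>
      ereal game_value \<le> (INF p\<in>chooser_strategies n. ereal (expected_fortune n v s p))"
    using s_strat upper lower order_trans by blast
  then show ?thesis
    by (simp add: guesser_optimal_def le_INF_iff)
qed

section \<open>Uniqueness of the choice at large wagers\<close>

text \<open>Testing \<open>p\<close> at wager \<open>w\<close> against each sure guess
  \<open>g\<close> gives one inequality per leaf. A mixture of them with positive weights is an
  equality, so all are equalities, and this makes \<open>pmf (p w) g * v g\<close> constant in
  \<open>g\<close>. At wagers up to \<open>1 - n * p_min\<close> the weight of a leaf of least
  probability is no longer positive.\<close>

lemma chooser_optimal_pmf:
  assumes opt: "chooser_optimal n v p" and w: "w \<in> {0..1}"
    and large: "n = 1 \<or> w > 1 - real n * p_min n v"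
    and j: "j \<in> {1..n}"
  shows "pmf (p w) j = cprob j"
proof -
  have p: "p \<in> chooser_strategies n"
    using opt by (simp add: chooser_optimal_iff)
  then have sub: "set_pmf (p w) \<subseteq> {1..n}"
    using w leaf_kernel_subset by (auto simp: chooser_strategies_def)
  then have sum_p: "(\<Sum>c=1..n. pmf (p w) c) = 1"
    by (intro sum_pmf_eq_1) auto
  show ?thesis
  proof (cases "n = 1")
    case True
    then show ?thesis
      using sum_p j by (simp add: choice_prob_def)
  next
    case False
    with large have large: "w > 1 - real n * p_min n v"
      by simp
    with n_p_min_le_1 have "w > 0"
      by simp
    define a where "a c = pmf (p w) c * v c" for c
    \<comment> \<open>\<open>T\<close> is what the Guesser expects whatever the guess, and
      \<open>U g\<close> the conditional expectation when leaf \<open>g\<close> is guessed.\<close>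
    define T where "T = (1 - w) * (\<Sum>c=1..n. a c)"
    define U where "U g = T + real n * w * a g" for g
    have U_le: "U g \<le> game_value" if g: "g \<in> {1..n}" for g
    proof -
      have g': "set_pmf (return_pmf g) \<subseteq> {1..n}"
        using g by simp
      have "cond_fortune w (return_pmf g) (p w) =
          (\<Sum>c=1..n. (1 - w) * a c + (if c = g then real n * w * a g else 0))"
        unfolding cond_fortune_multi[OF False g' sub]
        by (intro sum.cong) (auto simp: a_def algebra_simps)
      also have "\<dots> = U g"
        using g by (simp add: U_def T_def sum.distrib flip: sum_distrib_left)
      finally show ?thesis
        using opt expected_fortune_return[OF w g' p] by (auto simp: chooser_optimal_iff)
    qed
    \<comment> \<open>Up to the factor \<open>n * w\<close>, the weights \<open>d\<close> are the Guesser's equalizing mixture,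
        all of whose entries are positive for such a wager.\<close>
    define d where "d g = real n * cprob g - 1 + w" for g
    have d_pos: "d g > 0" if "g \<in> {1..n}" for g
    proof -
      have "real n * p_min n v \<le> real n * cprob g"
        using p_min_le[OF that] by (simp add: mult_left_mono)
      then show ?thesis
        using large by (simp add: d_def)
    qed
    have sum_d: "(\<Sum>g=1..n. d g) = real n * w"
      by (simp add: d_def sum.distrib sum_subtractf sum_cprob algebra_simps flip: sum_distrib_left)
    have "(\<Sum>g=1..n. d g * a g) = (\<Sum>g=1..n. pmf (p w) g * game_value - (1 - w) * a g)"
      using False n_v_cprob
      by (intro sum.cong) (auto simp: d_def a_def algebra_simps simp flip: n_v_cprob)
    also have "\<dots> = game_value - T"
      by (simp add: T_def sum_subtractf sum_p flip: sum_distrib_left sum_distrib_right)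
    finally have sum_da: "(\<Sum>g=1..n. d g * a g) = game_value - T" .
    \<comment> \<open>The gaps \<open>game_value - U g\<close>, weighted by \<open>d\<close>, sum to
      zero; since no gap is negative and every weight is positive, all gaps vanish.\<close>
    have "(\<Sum>g=1..n. d g * (game_value - U g)) =
        (\<Sum>g=1..n. d g) * (game_value - T) - real n * w * (\<Sum>g=1..n. d g * a g)"
      by (simp add: U_def algebra_simps sum.distrib sum_subtractf sum_distrib_left sum_distrib_right)
    also have "\<dots> = 0"
      by (simp add: sum_d sum_da)
    finally have "(\<Sum>g=1..n. d g * (game_value - U g)) = 0" .
    then have "\<forall>g\<in>{1..n}. d g * (game_value - U g) = 0"
      using d_pos U_le by (subst (asm) sum_nonneg_eq_0_iff) (auto simp: less_imp_le)
    then have U_eq: "U g = game_value" if "g \<in> {1..n}" for g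
      using d_pos[OF that] that by fastforce
    have a_eq: "a g = a j" if "g \<in> {1..n}" for g
    proof -
      have "real n * w * a g = real n * w * a j"
        using U_eq[OF that] U_eq[OF j] unfolding U_def by linarith
      then show ?thesis
        using \<open>w > 0\<close> n_ge_1 by simp
    qed
    \<comment> \<open>The choice probabilities are thus proportional to
      \<open>inverse (v g)\<close>, and normalization fixes the factor.\<close>
    have "pmf (p w) g = a j * inverse (v g)" if "g \<in> {1..n}" for g
      using a_eq[OF that] v_pos[OF that] by (simp add: a_def field_simps)
    then have "(\<Sum>g=1..n. a j * inverse (v g)) = 1"
      using sum_p by simp
    then have "a j * (\<Sum>g=1..n. inverse (v g)) = 1"
      by (simp add: sum_distrib_left)
    then show ?thesis
      using False v_pos[OF j] sum_inverse_pos by (simp add: choice_prob_def a_def field_simps)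
  qed
qed

section \<open>The laws of the Guesser's wagers\<close>

lemma wager_measurable: "wager n v \<in> measurable unit_borel unit_borel"
proof (rule measurable_restrict_space2)
  show "wager n v \<in> borel_measurable unit_borel"
    unfolding wager_def[abs_def] by measurable
  have "0 \<le> wager n v b \<and> wager n v b \<le> 1" if "0 \<le> b" "b \<le> 1" for b
  proof -
    have "0 \<le> b * (real n * p_min n v)" "b * (real n * p_min n v) \<le> 1"
      using that p_min_pos n_p_min_le_1 by (auto intro!: mult_le_one)
    then show ?thesis
      by (simp add: wager_def ac_simps)
  qed
  then show "wager n v \<in> space unit_borel \<rightarrow> {0..1}"
    by (simp add: space_restrict_space)
qed

text \<open>Within the unit interval this is the range of \<open>wager n v\<close> on
  \<open>{0..1}\<close>.\<close>

definition admissible_wager :: "real \<Rightarrow> bool" where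
  "admissible_wager w \<longleftrightarrow> (if n = 1 then w = 1 else w \<ge> 1 - real n * p_min n v)"

lemma admissible_wager_measurable [measurable]: "Measurable.pred unit_borel admissible_wager"
  unfolding admissible_wager_def[abs_def] by measurable

lemma wager_admissible:
  assumes "b \<in> {0..1}"
  shows "admissible_wager (wager n v b)"
proof -
  have "b * (real n * p_min n v) \<le> 1 * (real n * p_min n v)"
    using assms p_min_pos by (intro mult_right_mono) auto
  then show ?thesis
    by (simp add: admissible_wager_def wager_def ac_simps)
qed

text \<open>For \<open>n \<ge> 2\<close> the wager is an affine function of \<open>b\<close> with
  nonzero slope, so an admissible law can be pulled back along its inverse. For \<open>n = 1\<close>
  both the function and an admissible wager are constantly 1.\<close>

lemma distr_wager_iff:
  assumes M: "M \<in> unit_laws"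
  shows "(\<exists>B\<in>unit_laws. M = distr B unit_borel (wager n v)) \<longleftrightarrow> (AE w in M. admissible_wager w)"
proof
  assume "\<exists>B\<in>unit_laws. M = distr B unit_borel (wager n v)"
  then obtain B where B: "B \<in> unit_laws" "M = distr B unit_borel (wager n v)"
    by blast
  have meas: "wager n v \<in> measurable B unit_borel"
    using wager_measurable measurable_cong_sets[OF unit_law_sets[OF B(1)] refl] by blast
  have "{w \<in> space unit_borel. admissible_wager w} \<in> sets unit_borel"
    by measurable
  moreover have "AE b in B. admissible_wager (wager n v b)"
    using wager_admissible by (intro AE_I2) (simp add: unit_law_space[OF B(1)])
  ultimately show "AE w in M. admissible_wager w"
    unfolding B(2) by (subst AE_distr_iff[OF meas])
next
  assume adm: "AE w in M. admissible_wager w"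
  \<comment> \<open>For \<open>n \<ge> 2\<close> this inverts \<open>wager n v\<close>. The cut at 1
    keeps \<open>b\<close> in the unit interval at inadmissible wagers and has no effect at
    admissible ones.\<close>
  define b where "b w = min 1 ((1 - w) / (real n * p_min n v))" for w
  have b_meas: "b \<in> measurable unit_borel unit_borel"
  proof (rule measurable_restrict_space2)
    show "b \<in> borel_measurable unit_borel"
      unfolding b_def[abs_def] by measurable
    show "b \<in> space unit_borel \<rightarrow> {0..1}"
      using p_min_pos n_ge_1 by (auto simp: b_def space_restrict_space)
  qed
  have M_cong: "f \<in> measurable M unit_borel \<longleftrightarrow> f \<in> measurable unit_borel unit_borel"
    for f :: "real \<Rightarrow> real"
    using measurable_cong_sets[OF unit_law_sets[OF M] refl] by blast
  have inv: "wager n v (b w) = w" if "admissible_wager w" for w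
  proof (cases "n = 1")
    case False
    have pos: "real n * p_min n v > 0"
      using n_ge_1 p_min_pos by simp
    have "b w = (1 - w) / (real n * p_min n v)"
      using that False pos by (simp add: b_def admissible_wager_def field_simps)
    then have "b w * (real n * p_min n v) = 1 - w"
      using pos by (metis less_irrefl nonzero_eq_divide_eq)
    with False show ?thesis
      by (simp add: wager_def ac_simps)
  qed (use that[unfolded admissible_wager_def] in \<open>simp add: wager_def\<close>)
  have "distr (distr M unit_borel b) unit_borel (wager n v) = distr M unit_borel (wager n v \<circ> b)"
    using b_meas wager_measurable by (intro distr_distr) (simp_all add: M_cong)
  \<comment> \<open>The composition is the identity at admissible wagers, hence almost surely, which
    suffices for equality of the laws.\<close>
  also have "\<dots> = distr M unit_borel (\<lambda>w. w)"
  proof (rule distr_cong_AE[OF refl refl])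
    show "AE w in M. (wager n v \<circ> b) w = w"
      using adm by eventually_elim (simp add: inv)
    show "wager n v \<circ> b \<in> measurable M unit_borel"
      using b_meas wager_measurable by (simp add: M_cong measurable_comp)
    show "(\<lambda>w. w) \<in> measurable M unit_borel"
      by (simp add: M_cong)
  qed
  also have "\<dots> = M"
    using unit_law_sets[OF M] by (simp add: distr_id2)
  finally show "\<exists>B\<in>unit_laws. M = distr B unit_borel (wager n v)"
    using distr_unit_law[OF M b_meas] by metis
qed

section \<open>Equalizing guesses and the Guesser's optimal strategies\<close>

text \<open>A single leaf leaves nothing to equalize; there the clause \<open>w = 1\<close> picks
  the only wager that reaches the value.\<close>

definition equalizing :: "real \<Rightarrow> nat pmf \<Rightarrow> bool" where
  "equalizing w q \<longleftrightarrow> (if n = 1 then w = 1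
     else \<forall>c\<in>{1..n}. v c * (1 - w + real n * w * pmf q c) = game_value)"

text \<open>For \<open>n \<ge> 2\<close>, dividing by \<open>v c\<close> turns the condition into
  \<open>n * w * q c = n * cprob c - 1 + w\<close>. For \<open>w \<noteq> 0\<close> this is the
  formula \<open>guess_prob\<close>; as the left side is nonnegative, a leaf of least probability
  forces the wager to be admissible.\<close>

lemma equalizing_iff:
  assumes w: "w \<in> {0..1}" and q: "set_pmf q \<subseteq> {1..n}"
  shows "equalizing w q \<longleftrightarrow>
    admissible_wager w \<and> (w \<noteq> 0 \<longrightarrow> (\<forall>j\<in>{1..n}. pmf q j = guess_prob n v w j))"
proof (cases "n = 1")
  case True
  have "(\<Sum>c=1..n. pmf q c) = 1"
    using q by (intro sum_pmf_eq_1) auto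
  with True show ?thesis
    unfolding equalizing_def admissible_wager_def guess_prob_def by simp
next
  case False
  have eq: "v c * (1 - w + real n * w * pmf q c) = game_value \<longleftrightarrow>
      real n * w * pmf q c = real n * cprob c - 1 + w" if c: "c \<in> {1..n}" for c
  proof -
    have "v c * (1 - w + real n * w * pmf q c) = game_value \<longleftrightarrow>
        v c * (1 - w + real n * w * pmf q c) = v c * (real n * cprob c)"
      using n_v_cprob[OF False c] by (simp add: ac_simps)
    also have "\<dots> \<longleftrightarrow> real n * w * pmf q c = real n * cprob c - 1 + w"
      using v_pos[OF c] by auto
    finally show ?thesis .
  qed
  have eq': "equalizing w q \<longleftrightarrow> (\<forall>c\<in>{1..n}. real n * w * pmf q c = real n * cprob c - 1 + w)"
    using eq False by (simp add: equalizing_def)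
  have guess: "pmf q j = guess_prob n v w j \<longleftrightarrow> real n * w * pmf q j = real n * cprob j - 1 + w"
    if "w \<noteq> 0" for j
    using that n_ge_1 False by (simp add: guess_prob_def field_simps)
  show ?thesis
  proof (intro iffI conjI impI)
    assume e: "equalizing w q"
    have "p_min n v \<in> cprob ` {1..n}"
      unfolding p_min_def using n_ge_1 by (intro Min_in) auto
    then obtain c where c: "c \<in> {1..n}" "p_min n v = cprob c"
      by blast
    have "0 \<le> real n * w * pmf q c"
      using w by simp
    then show "admissible_wager w"
      using e c False by (simp add: eq' admissible_wager_def)
    show "\<forall>j\<in>{1..n}. pmf q j = guess_prob n v w j" if "w \<noteq> 0"
      using e guess[OF that] by (simp add: eq')
  next
    assume a: "admissible_wager w \<and> (w \<noteq> 0 \<longrightarrow> (\<forall>j\<in>{1..n}. pmf q j = guess_prob n v w j))"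
    show "equalizing w q"
    proof (cases "w = 0")
      case True
      \<comment> \<open>Wager 0 is admissible only if all choice probabilities are equal: the
        nonnegative numbers \<open>n * cprob c - 1\<close> sum to 0.\<close>
      have ge: "0 \<le> real n * cprob c - 1" if "c \<in> {1..n}" for c
      proof -
        have "real n * p_min n v \<le> real n * cprob c"
          using p_min_le[OF that] by (simp add: mult_left_mono)
        then show ?thesis
          using a True False by (simp add: admissible_wager_def)
      qed
      have "(\<Sum>c=1..n. real n * cprob c - 1) = 0"
        by (simp add: sum_subtractf sum_cprob flip: sum_distrib_left)
      then have "\<forall>c\<in>{1..n}. real n * cprob c - 1 = 0"
        using ge by (subst (asm) sum_nonneg_eq_0_iff) auto
      then show ?thesis
        unfolding eq' using True by simp
    next
      case nz: False
      then show ?thesis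
        using a guess[OF nz] by (simp add: eq')
    qed
  qed
qed

lemma cond_fortune_equalizing:
  assumes "equalizing w q" "set_pmf q \<subseteq> {1..n}" "set_pmf p \<subseteq> {1..n}"
  shows "cond_fortune w q p = game_value"
proof (cases "n = 1")
  case True
  then show ?thesis
    using assms unfolding equalizing_def game_value_def by (subst cond_fortune_single) simp_all
next
  case False
  have "cond_fortune w q p = (\<Sum>c=1..n. pmf p c * game_value)"
    using assms False by (simp add: cond_fortune_multi equalizing_def)
  also have "\<dots> = game_value"
    using assms(3) by (simp add: sum_pmf_eq_1 flip: sum_distrib_right)
  finally show ?thesis .
qed

text \<open>Here \<open>f\<close> is what the Chooser saves at each wager compared with the value.
  Optimality of the Guesser keeps its mean from being positive, so the nonnegative \<open>f\<close>
  vanishes almost surely; the bound \<open>K\<close> provides integrability.\<close>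

lemma guesser_optimal_saving:
  assumes opt: "guesser_optimal n v s"
    and p: "p \<in> chooser_strategies n"
    and f: "f \<in> borel_measurable unit_borel"
      "\<And>w. w \<in> {0..1} \<Longrightarrow> 0 \<le> f w" "\<And>w. w \<in> {0..1} \<Longrightarrow> f w \<le> K"
    and eq: "\<And>w. w \<in> {0..1} \<Longrightarrow> cond_fortune w (snd s w) (p w) = game_value - f w"
  shows "AE w in fst s. f w = 0"
proof -
  have M: "fst s \<in> unit_laws"
    using opt by (auto simp: guesser_optimal_def guesser_strategies_def)
  interpret prob_space "fst s"
    by (rule unit_law_prob_space[OF M])
  have int: "integrable (fst s) f"
    using f by (intro integrable_const_bound[where B = K] AE_I2)
      (simp_all add: measurable_cong_sets[OF unit_law_sets[OF M] refl] unit_law_space[OF M])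
  have "expected_fortune n v s p = (\<integral>w. game_value - f w \<partial>fst s)"
    unfolding expected_fortune_eq
    by (rule Bochner_Integration.integral_cong[OF refl]) (simp add: eq unit_law_space[OF M])
  also have "\<dots> = game_value - (\<integral>w. f w \<partial>fst s)"
    using int by (simp add: prob_space)
  finally have "(\<integral>w. f w \<partial>fst s) \<le> 0"
    using opt p by (auto simp: guesser_optimal_iff)
  moreover have nonneg: "AE w in fst s. 0 \<le> f w"
    using f(2) by (intro AE_I2) (simp add: unit_law_space[OF M])
  ultimately have "(\<integral>w. f w \<partial>fst s) = 0"
    using integral_nonneg_AE[OF nonneg] by simp
  then show ?thesis
    using integral_nonneg_eq_0_iff_AE[OF int nonneg] by simp
qed

text \<open>For \<open>n \<ge> 2\<close>, the Chooser's deviations show only that almost surely no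
  leaf pays less than the value. Equality follows because the mean of the payoffs under the positive
  weights \<open>cprob\<close> is exactly the value.\<close>

lemma guesser_optimal_iff_equalizing:
  assumes s: "s \<in> guesser_strategies n"
  shows "guesser_optimal n v s \<longleftrightarrow> (AE w in fst s. equalizing w (snd s w))"
proof
  have M: "fst s \<in> unit_laws" and q: "snd s \<in> leaf_kernels n"
    using s by (auto simp: guesser_strategies_def)
  note sub = leaf_kernel_subset[OF q]
  obtain r where r: "set_pmf r \<subseteq> {1..n}" "\<And>j. j \<in> {1..n} \<Longrightarrow> pmf r j = cprob j"
    using ex_choice_pmf by blast
  {
    assume eq: "AE w in fst s. equalizing w (snd s w)"
    show "guesser_optimal n v s"
      unfolding guesser_optimal_iff
    proof (intro conjI ballI s)
      fix p assume p: "p \<in> chooser_strategies n"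
      have "AE w in fst s. cond_fortune w (snd s w) (p w) = game_value"
        using eq AE_space
      proof eventually_elim
        case (elim w)
        then show ?case
          using p sub leaf_kernel_subset[of p n]
          by (intro cond_fortune_equalizing)
             (simp_all add: unit_law_space[OF M] chooser_strategies_def)
      qed
      then show "game_value \<le> expected_fortune n v s p"
        using expected_fortune_AE_const[OF s p] by simp
    qed
  next
    assume opt: "guesser_optimal n v s"
    show "AE w in fst s. equalizing w (snd s w)"
    proof (cases "n = 1")
      case True
      \<comment> \<open>On a single leaf, wager \<open>w\<close> falls short of the value by
        \<open>(1 - w) * v 1\<close>.\<close>
      have "AE w in fst s. (1 - w) * v 1 = 0"
      proof (rule guesser_optimal_saving[OF opt, where p = "\<lambda>_. r" and K = "v 1"])
        show "(\<lambda>_. r) \<in> chooser_strategies n"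
          using r by (simp add: chooser_strategies_def const_leaf_kernel)
        show "(\<lambda>w. (1 - w) * v 1) \<in> borel_measurable unit_borel"
          by measurable
        show "cond_fortune w (snd s w) r = game_value - (1 - w) * v 1" if "w \<in> {0..1}" for w
          unfolding game_value_def using sub[OF that] r(1) True
          by (subst cond_fortune_single) (simp_all add: algebra_simps)
        show "0 \<le> (1 - w) * v 1" "(1 - w) * v 1 \<le> v 1" if "w \<in> {0..1}" for w
          using that v_pos[of 1] True by (simp_all add: mult_le_cancel_right1)
      qed
      then show ?thesis
        unfolding equalizing_def by eventually_elim (use v_pos[of 1] True in simp)
    next
      case False
      define h where "h c w = v c * (1 - w + real n * w * pmf (snd s w) c)" for c w
      have h_meas [measurable]: "h c \<in> borel_measurable unit_borel" for c
        using leaf_kernel_measurable[OF q] unfolding h_def[abs_def] by measurable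
      have h_nonneg: "0 \<le> h c w" if "c \<in> {1..n}" "w \<in> {0..1}" for c w
        using that v_pos[of c] by (simp add: h_def)
      have ge: "AE w in fst s. game_value \<le> h c w" if c: "c \<in> {1..n}" for c
      proof -
        \<comment> \<open>Where leaf \<open>c\<close> pays at least the value, \<open>r\<close>
          concedes exactly the value, so this deviation never costs the Chooser anything.\<close>
        define p where "p w = (if h c w < game_value then return_pmf c else r)" for w
        have "AE w in fst s. max 0 (game_value - h c w) = 0"
        proof (rule guesser_optimal_saving[OF opt, where p = p and K = "\<bar>game_value\<bar>"])
          show "p \<in> chooser_strategies n"
            unfolding p_def[abs_def] chooser_strategies_def
            using c r by (intro leaf_kernel_If const_leaf_kernel) auto
          show "(\<lambda>w. max 0 (game_value - h c w)) \<in> borel_measurable unit_borel"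
            by measurable
          show "max 0 (game_value - h c w) \<le> \<bar>game_value\<bar>" if "w \<in> {0..1}" for w
            using h_nonneg[OF c that] by simp
          show "cond_fortune w (snd s w) (p w) = game_value - max 0 (game_value - h c w)"
            if w: "w \<in> {0..1}" for w
          proof (cases "h c w < game_value")
            case True
            have "cond_fortune w (snd s w) (return_pmf c) =
                (\<Sum>d=1..n. if d = c then h c w else 0)"
              using c sub[OF w] by (subst cond_fortune_multi[OF False])
                (simp_all add: h_def indicator_def if_distrib cong: if_cong)
            then show ?thesis
              using True c by (simp add: p_def)
          next
            case nl: False
            then show ?thesis
              using cond_fortune_cprob_choice[OF sub[OF w] r False] by (simp add: p_def)
          qed
        qed simp
        then show ?thesis
          by eventually_elim simp
      qed
      \<comment> \<open>There are finitely many leaves, so one null set serves them all.\<close>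
      have "AE w in fst s. \<forall>c\<in>{1..n}. game_value \<le> h c w"
        using ge by (simp add: AE_ball_countable)
      then show ?thesis
        using AE_space
      proof eventually_elim
        case (elim w)
        then have w: "w \<in> {0..1}"
          by (simp add: unit_law_space[OF M])
        have "(\<Sum>c=1..n. cprob c * h c w) = game_value"
          using cond_fortune_cprob_choice[OF sub[OF w] r False, of w] r
          by (simp add: cond_fortune_multi[OF False sub[OF w]] h_def)
        then have "(\<Sum>c=1..n. cprob c * (h c w - game_value)) = 0"
          by (simp add: right_diff_distrib sum_subtractf sum_cprob flip: sum_distrib_right)
        then have "\<forall>c\<in>{1..n}. cprob c * (h c w - game_value) = 0"
          using elim cprob_pos by (subst (asm) sum_nonneg_eq_0_iff) (auto simp: less_imp_le)
        then show ?case
          using False cprob_pos by (fastforce simp: equalizing_def h_def)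
      qed
    qed
  }
qed

text \<open>The condition of \<open>equalizing_iff\<close> splits: almost sure admissibility
  accounts for the index law \<open>B\<close>, and the rest is the formula for the guess.\<close>

lemma guesser_optimal_iff_family:
  "guesser_optimal n v s \<longleftrightarrow> (\<exists>B\<in>unit_laws. s \<in> guesser_family n v B)"
proof (cases "s \<in> guesser_strategies n")
  case True
  then have M: "fst s \<in> unit_laws" and q: "snd s \<in> leaf_kernels n"
    by (auto simp: guesser_strategies_def)
  have "guesser_optimal n v s \<longleftrightarrow> (AE w in fst s. admissible_wager w \<and>
      (w \<noteq> 0 \<longrightarrow> (\<forall>j\<in>{1..n}. pmf (snd s w) j = guess_prob n v w j)))"
    unfolding guesser_optimal_iff_equalizing[OF True]
    using leaf_kernel_subset[OF q]
    by (intro AE_cong equalizing_iff) (simp_all add: unit_law_space[OF M])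
  also have "\<dots> \<longleftrightarrow> (\<exists>B\<in>unit_laws. s \<in> guesser_family n v B)"
    using True distr_wager_iff[OF M] by (auto simp: guesser_family_def)
  finally show ?thesis .
next
  case False
  then show ?thesis
    by (auto simp: guesser_optimal_def guesser_family_def)
qed

section \<open>Every index law has a strategy\<close>

text \<open>For \<open>n \<ge> 2\<close>, admissibility keeps the numerators of
  \<open>guess_prob\<close> nonnegative, and they sum to \<open>n * w\<close>.\<close>

lemma guess_prob_distribution:
  assumes "admissible_wager w" "0 < w"
  shows "j \<in> {1..n} \<Longrightarrow> 0 \<le> guess_prob n v w j" and "(\<Sum>j=1..n. guess_prob n v w j) = 1"
proof -
  show "0 \<le> guess_prob n v w j" if "j \<in> {1..n}"
  proof -
    have "real n * p_min n v \<le> real n * cprob j"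
      using p_min_le[OF that] by (simp add: mult_left_mono)
    then show ?thesis
      using assms by (auto simp: guess_prob_def admissible_wager_def split: if_splits)
  qed
  have "(\<Sum>j=1..n. real n * cprob j - 1 + w) = real n * w"
    by (simp add: sum.distrib sum_subtractf sum_cprob algebra_simps flip: sum_distrib_left)
  then show "(\<Sum>j=1..n. guess_prob n v w j) = 1"
    using assms(2) n_ge_1
    by (cases "n = 1") (simp_all add: guess_prob_def flip: sum_divide_distrib)
qed

lemma guesser_family_nonempty:
  assumes B: "B \<in> unit_laws"
  shows "guesser_family n v B \<noteq> {}"
proof -
  define M where "M = distr B unit_borel (wager n v)"
  have M: "M \<in> unit_laws"
    unfolding M_def by (rule distr_unit_law[OF B wager_measurable])
  obtain r where r: "set_pmf r \<subseteq> {1..n}" "\<And>j. j \<in> {1..n} \<Longrightarrow> pmf r j = cprob j"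
    using ex_choice_pmf by blast
  \<comment> \<open>In the unit interval the default \<open>cprob\<close> is used at wager 0, which
    the family leaves unconstrained, and at inadmissible wagers, which form a null set. The case
    distinction is measurable, so the result is a kernel.\<close>
  have "\<forall>w. \<exists>q. set_pmf q \<subseteq> {1..n} \<and> (\<forall>j\<in>{1..n}. pmf q j =
      (if admissible_wager w \<and> 0 < w then guess_prob n v w j else cprob j))"
  proof
    fix w
    show "\<exists>q. set_pmf q \<subseteq> {1..n} \<and> (\<forall>j\<in>{1..n}. pmf q j =
        (if admissible_wager w \<and> 0 < w then guess_prob n v w j else cprob j))"
      using r guess_prob_distribution[of w]
        ex_pmf_on_finite[of "{1..n}" "guess_prob n v w"]
      by (cases "admissible_wager w \<and> 0 < w") auto
  qed
  then obtain q where q: "\<And>w. set_pmf (q w) \<subseteq> {1..n}"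
    "\<And>w j. j \<in> {1..n} \<Longrightarrow> pmf (q w) j =
       (if admissible_wager w \<and> 0 < w then guess_prob n v w j else cprob j)"
    by metis
  have "(\<lambda>w. pmf (q w) j) \<in> borel_measurable unit_borel" for j
  proof (cases "j \<in> {1..n}")
    case True
    have "(\<lambda>w. if admissible_wager w \<and> 0 < w then guess_prob n v w j else cprob j)
        \<in> borel_measurable unit_borel"
      unfolding guess_prob_def by measurable
    with True show ?thesis
      by (simp add: q(2))
  next
    case False
    then have "pmf (q w) j = 0" for w
      using q(1)[of w] by (auto simp: pmf_eq_0_set_pmf)
    then show ?thesis
      by simp
  qed
  then have kernel: "q \<in> leaf_kernels n"
    using q(1) by (simp add: leaf_kernels_def)
  have "AE w in M. admissible_wager w"
    using distr_wager_iff[OF M] B M_def by blast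
  then have "AE w in M. w \<noteq> 0 \<longrightarrow> (\<forall>j\<in>{1..n}. pmf (q w) j = guess_prob n v w j)"
    using AE_space by eventually_elim (auto simp: q(2) unit_law_space[OF M])
  then have "(M, q) \<in> guesser_family n v B"
    using M kernel
    unfolding guesser_family_def guesser_strategies_def by (auto simp only: fst_conv snd_conv M_def)
  then show ?thesis
    by blast
qed

section \<open>The constant optimal choice and the outcome of optimal play\<close>

text \<open>A choice that ignores the wager can be read off at wager 1, which lies above the
  threshold \<open>1 - n * p_min\<close>.\<close>

lemma chooser_optimal_const_iff:
  assumes r: "set_pmf r \<subseteq> {1..n}" "\<And>j. j \<in> {1..n} \<Longrightarrow> pmf r j = cprob j"
  shows "chooser_optimal n v (\<lambda>w. r') \<longleftrightarrow> r' = r"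
proof
  assume opt: "chooser_optimal n v (\<lambda>w. r')"
  then have "set_pmf r' \<subseteq> {1..n}"
    using leaf_kernel_subset[of "\<lambda>w. r'" n 1]
    by (simp add: chooser_optimal_iff chooser_strategies_def)
  moreover have "real n * p_min n v > 0"
    using n_ge_1 p_min_pos by simp
  then have "pmf r' j = pmf r j" if "j \<in> {1..n}" for j
    using chooser_optimal_pmf[OF opt, of 1 j] that r(2) by simp
  ultimately show "r' = r"
    using r(1) by (intro pmf_eqI_on)
next
  assume "r' = r"
  then show "chooser_optimal n v (\<lambda>w. r')"
    using r expected_fortune_cprob_choice
    by (simp add: chooser_optimal_iff chooser_strategies_def const_leaf_kernel)
qed

lemma optimal_play_value:
  assumes "guesser_optimal n v s" "chooser_optimal n v p"
  shows "expected_fortune n v s p = game_value"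
  using assms by (auto simp: guesser_optimal_iff chooser_optimal_iff intro: antisym)

end

text \<open>A Chooser who reacts to the wager can have freedom at small wagers: at wager 0 with
  unequal values, going to a cheapest leaf concedes less than the value. Hence uniqueness refers to
  choices independent of the wager and, for arbitrary kernels, to wagers above the
  threshold.\<close>

theorem theorem1:
  fixes n :: nat and v :: "nat \<Rightarrow> real"
  assumes "n \<ge> 1"
    and "\<And>j. j \<in> {1..n} \<Longrightarrow> v j > 0"
  shows
    "(\<exists>r. (\<forall>j\<in>{1..n}. pmf r j = choice_prob n v j) \<and>
          (\<forall>r'. chooser_optimal n v (\<lambda>w. r') \<longleftrightarrow> r' = r)) \<and>
     (\<forall>p. chooser_optimal n v p \<longrightarrow>
          (\<forall>w\<in>{0..1}. n = 1 \<or> w > 1 - real n * p_min n v \<longrightarrow>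
             (\<forall>j\<in>{1..n}. pmf (p w) j = choice_prob n v j))) \<and>
     (\<forall>s. guesser_optimal n v s \<longleftrightarrow> (\<exists>B\<in>unit_laws. s \<in> guesser_family n v B)) \<and>
     (\<forall>B\<in>unit_laws. guesser_family n v B \<noteq> {}) \<and>
     (\<forall>s p. guesser_optimal n v s \<and> chooser_optimal n v p \<longrightarrow>
        expected_fortune n v s p =
          (if n = 1 then 2 * v 1 else real n / (\<Sum>j=1..n. inverse (v j))))"
proof -
  interpret fan n v
    by standard (use assms in auto)
  obtain r where r: "set_pmf r \<subseteq> {1..n}" "\<And>j. j \<in> {1..n} \<Longrightarrow> pmf r j = choice_prob n v j"
    using ex_choice_pmf by blast
  show ?thesis
    using r chooser_optimal_const_iff[OF r] chooser_optimal_pmf guesser_optimal_iff_family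
      guesser_family_nonempty optimal_play_value[unfolded game_value_def]
    by (intro conjI exI[of _ r]) simp_all
qed

end
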